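(* If there exists a selective ultrafilter on $\omega$ and $\max\{\mathfrak{b},\mathfrak{g}\}=\mathfrak{d}$, then there exists a Michael space.
   Context: A Michael space is a Lindelöf space whose product with the Baire space $\omega^\omega$ is not Lindelöf. All ultrafilters are non-principal ultrafilters on $\omega$. An ultrafilter $\mathscr{U}$ is a p-point if every decreasing sequence $\{U_i : i\in\omega\}\subseteq\mathscr{U}$ has a pseudointersection in $\mathscr{U}$, i.e. a set $U\in\mathscr{U}$ with $U\setminus U_n$ finite for all $n$. $\mathscr{U}$ is a q-point if for every partition $\langle I_n : n\in\omega\rangle$ of $\omega$ into (finite) intervals there is $U\in\mathscr{U}$ with $|U\cap I_n|\leq 1$ for all $n$. $\mathscr{U}$ is selective if it is both a p-point and a q-point. For $f,g\in\omega^\omega$, $f\leq^* g$ means $\{n : f(n)>g(n)\}$ is finite. $\mathfrak{b}$ is the least cardinality of a set $B\subseteq\omega^\omega$ such that for every $g\in\omega^\omega$ there is $f\in B$ with $f\nleq^* g$. $\mathfrak{d}$ is the least cardinality of a set $D\subseteq\omega^\omega$ such that for every $g\in\omega^\omega$ there is $f\in D$ with $g\leq^* f$. A set $G\subseteq[\omega]^\omega$ (infinite subsets of $\omega$) is groupwise dense if $G$ is closed under infinite subsets and finite modifications, and for every partition $\langle I_n : n\in\omega\rangle$ of $\omega$ into finite intervals there is an infinite $A\subseteq\omega$ such that $\bigcup_{n\in A} I_n\in G$. $\mathfrak{g}$ is the least cardinality of a collection of groupwise dense sets with empty intersection. *)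

theory Defs
  imports "HOL-Analysis.Analysis"
begin

unbundle cardinal_syntax

section \<open>Michael spaces\<close>

definition baire_space :: "(nat \<Rightarrow> nat) topology" where
  "baire_space = product_topology (\<lambda>_. discrete_topology UNIV) UNIV"

definition Michael_space :: "'a topology \<Rightarrow> bool" where
  "Michael_space X \<longleftrightarrow>
     Lindelof_space X \<and> \<not> Lindelof_space (prod_topology X baire_space)"

text \<open>
  Existence over arbitrary types is not expressible in HOL, so existence of a Michael space is
  stated for topologies whose underlying set lies in a fixed type of cardinality \<open>2\<close> to the continuum.
\<close>

section \<open>Ultrafilters on the natural numbers\<close>

text \<open>
  An ultrafilter is a value of the library type \<^typ>\<open>nat filter\<close>; the set \<open>A\<close> belongs to
  \<open>U\<close> iff \<open>\<forall>\<^sub>F n in U. n \<in> A\<close>.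
\<close>

definition nonprincipal_ultrafilter :: "nat filter \<Rightarrow> bool" where
  "nonprincipal_ultrafilter U \<longleftrightarrow>
     U \<noteq> bot \<and>
     (\<forall>A. (\<forall>\<^sub>F n in U. n \<in> A) \<or> (\<forall>\<^sub>F n in U. n \<in> - A)) \<and>
     (\<forall>k. \<not> (\<forall>\<^sub>F n in U. n \<in> {k}))"

definition interval_partition :: "(nat \<Rightarrow> nat set) \<Rightarrow> bool" where
  "interval_partition I \<longleftrightarrow>
     (\<forall>n. \<exists>a b. a < b \<and> I n = {a..<b}) \<and> disjoint_family I \<and> (\<Union>n. I n) = UNIV"

definition p_point :: "nat filter \<Rightarrow> bool" where
  "p_point U \<longleftrightarrow>
     nonprincipal_ultrafilter U \<and>
     (\<forall>A. decseq A \<and> (\<forall>i. \<forall>\<^sub>F n in U. n \<in> A i) \<longrightarrow>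
        (\<exists>B. (\<forall>\<^sub>F n in U. n \<in> B) \<and> (\<forall>i. finite (B - A i))))"

definition q_point :: "nat filter \<Rightarrow> bool" where
  "q_point U \<longleftrightarrow>
     nonprincipal_ultrafilter U \<and>
     (\<forall>I. interval_partition I \<longrightarrow>
        (\<exists>B. (\<forall>\<^sub>F n in U. n \<in> B) \<and> (\<forall>k. card (B \<inter> I k) \<le> 1)))"

definition selective_ultrafilter :: "nat filter \<Rightarrow> bool" where
  "selective_ultrafilter U \<longleftrightarrow> p_point U \<and> q_point U"

section \<open>Cardinal characteristics\<close>

text \<open>
  Cardinals are the cardinal orders of the library, compared across types by \<open>\<le>o\<close> and
  \<open>=o\<close>.  \<open>least_card P\<close> is the least cardinality of a set satisfying \<open>P\<close>; it is meaningful
  when such a set exists.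
\<close>

definition least_card :: "('a set \<Rightarrow> bool) \<Rightarrow> 'a rel" where
  "least_card P = |SOME A. P A \<and> (\<forall>B. P B \<longrightarrow> |A| \<le>o |B| )|"

lemma least_card:
  assumes "P A0"
  shows "\<exists>A. P A \<and> least_card P = |A|"
    and "P B \<Longrightarrow> least_card P \<le>o |B|"
proof -
  have "\<exists>r\<in>card_of ` {A. P A}. \<forall>r'\<in>card_of ` {A. P A}. r \<le>o r'"
    by (rule exists_minim_Card_order) (use assms card_of_Card_order in auto)
  then have *: "\<exists>A. P A \<and> (\<forall>B. P B \<longrightarrow> |A| \<le>o |B| )"
    by auto
  show "\<exists>A. P A \<and> least_card P = |A|" "P B \<Longrightarrow> least_card P \<le>o |B|"
    using someI_ex[OF *] unfolding least_card_def by blast+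
qed

definition is_max_card :: "'a rel \<Rightarrow> 'b rel \<Rightarrow> 'c rel \<Rightarrow> bool" where
  "is_max_card r s t \<longleftrightarrow> r \<le>o t \<and> s \<le>o t \<and> (r =o t \<or> s =o t)"

definition le_star :: "(nat \<Rightarrow> nat) \<Rightarrow> (nat \<Rightarrow> nat) \<Rightarrow> bool"  (infix "\<le>\<^sup>*" 50) where
  "f \<le>\<^sup>* g \<longleftrightarrow> finite {n. f n > g n}"

definition bounding_number :: "(nat \<Rightarrow> nat) rel" where
  "bounding_number = least_card (\<lambda>B. \<forall>g. \<exists>f\<in>B. \<not> f \<le>\<^sup>* g)"

definition dominating_number :: "(nat \<Rightarrow> nat) rel" where
  "dominating_number = least_card (\<lambda>D. \<forall>g. \<exists>f\<in>D. g \<le>\<^sup>* f)"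

definition groupwise_dense :: "nat set set \<Rightarrow> bool" where
  "groupwise_dense G \<longleftrightarrow>
     (\<forall>A\<in>G. infinite A) \<and>
     (\<forall>A\<in>G. \<forall>B. B \<subseteq> A \<and> infinite B \<longrightarrow> B \<in> G) \<and>
     (\<forall>A\<in>G. \<forall>B. finite (A - B) \<and> finite (B - A) \<longrightarrow> B \<in> G) \<and>
     (\<forall>I. interval_partition I \<longrightarrow> (\<exists>A. infinite A \<and> (\<Union>n\<in>A. I n) \<in> G))"

definition groupwise_density_number :: "nat set set rel" where
  "groupwise_density_number =
     least_card (\<lambda>\<G>. (\<forall>G\<in>\<G>. groupwise_dense G) \<and> \<Inter>\<G> = {})"

end

theory Submission
  imports Defs
begin

text \<open>
  The space consists of all finite and infinite sequences of natural numbers.  A neighbourhood of a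
  finite sequence contains all infinite sequences that continue it with a large enough next entry; a
  neighbourhood of an infinite sequence \<open>p\<close> contains those infinite sequences close to \<open>p\<close> whose rank
  does not exceed that of \<open>p\<close>.  The rank comes from the selective ultrafilter \<open>U\<close>: let \<open>D\<close> be a
  family of least cardinality that dominates every function modulo \<open>U\<close>, well-ordered in type \<open>|D|\<close>;
  the rank of \<open>p\<close> is the first member of \<open>D\<close> that bounds \<open>p\<close> modulo \<open>U\<close>.

  The product with the Baire space is not Lindelof, because the diagonal is a closed set that is covered
  by the open sets of points of bounded rank, and countably many ranks never bound all others: an
  initial segment of \<open>D\<close> has smaller cardinality than \<open>D\<close> and so does not dominate, and countably
  many witnesses of this have a common upper bound (\<open>not_Lindelof_michael_times_baire\<close>).

  For the Lindelof property, countably many open sets cover the countably many finite sequences, and what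
  they leave uncovered lies in a compact set of infinite sequences.  Such a set is exhausted by removing
  relatively open pieces with countable subcovers, provided that the rank has a local maximum on every
  nonempty compact set (\<open>compact_branches_countable_subcover\<close>).

  The local maximum is where the hypotheses enter (\<open>rank_local_max\<close>).  The difficulty is that the
  pointwise maximum of a compact set need not belong to the set.  Shrink the set until the rank
  \<open>\<delta>\<close> of its pointwise maximum cannot decrease any more; one then looks for a member of the set
  that is not bounded modulo \<open>U\<close> by any predecessor of \<open>\<delta>\<close> (\<open>selective_escape\<close>).  The
  pointwise maxima of all smaller pieces exceed a given predecessor up to a depth that is unbounded
  modulo \<open>U\<close>.  To treat all predecessors at once, one needs a single function tending to infinity that lies, modulo \<open>U\<close>, below fewer than \<open>|D|\<close> given functions that are unbounded modulo
  \<open>U\<close>.  Since \<open>|D|\<close> is at most the dominating number, which is the bounding number or the groupwise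
  density number, such a function exists for any p-point
  (\<open>lower_bound_bounding\<close>, \<open>lower_bound_groupwise_density\<close>), and the q-point property supplies a set
  in \<open>U\<close> that is sparse enough to build the required member.
\<close>

section \<open>Cylinders and compact sets of branches\<close>

definition cylinder :: "(nat \<Rightarrow> nat) \<Rightarrow> nat \<Rightarrow> (nat \<Rightarrow> nat) set" where
  "cylinder p n = {q. \<forall>i<n. q i = p i}"

lemma cylinder_self [simp]: "p \<in> cylinder p n"
  by (simp add: cylinder_def)

lemma cylinder_0 [simp]: "cylinder p 0 = UNIV"
  by (simp add: cylinder_def)

lemma cylinder_eq: "q \<in> cylinder p n \<Longrightarrow> cylinder q n = cylinder p n"
  by (auto simp: cylinder_def)

lemma cylinder_antimono: "m \<le> n \<Longrightarrow> cylinder p n \<subseteq> cylinder p m"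
  by (auto simp: cylinder_def)

lemma cylinder_neq_singleton: "cylinder p n \<noteq> {q}"
proof
  assume "cylinder p n = {q}"
  moreover have "p(n := Suc (p n)) \<in> cylinder p n" by (simp add: cylinder_def)
  ultimately have "p(n := Suc (p n)) = p" using cylinder_self[of p n] by auto
  then show False by (metis fun_upd_same n_not_Suc_n)
qed

lemma cylinder_length_le:
  assumes "cylinder p m = cylinder q n"
  shows "n \<le> m"
proof (rule ccontr)
  assume "\<not> n \<le> m"
  then have "m < n" by simp
  have "p(m := Suc (p m)) \<in> cylinder p m" "p \<in> cylinder p m"
    by (auto simp: cylinder_def)
  then have "p(m := Suc (p m)) \<in> cylinder q n" "p \<in> cylinder q n"
    using assms by simp_all
  with \<open>m < n\<close> have "(p(m := Suc (p m))) m = q m" "p m = q m"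
    unfolding cylinder_def by blast+
  then show False by simp
qed

lemma cylinder_length_inject: "cylinder p m = cylinder q n \<Longrightarrow> m = n"
  by (metis cylinder_length_le order_antisym)

definition cylinders :: "(nat \<Rightarrow> nat) set set" where
  "cylinders = (\<lambda>(p, n). cylinder p n) ` UNIV"

lemma cylinder_in_cylinders [simp]: "cylinder p n \<in> cylinders"
  unfolding cylinders_def by (rule image_eqI[of _ _ "(p, n)"]) auto

lemma countable_cylinders: "countable cylinders"
proof -
  have "cylinders \<subseteq> (\<lambda>xs. {q. \<forall>i<length xs. q i = xs ! i}) ` (UNIV :: nat list set)"
  proof (clarsimp simp: cylinders_def)
    fix p n
    show "cylinder p n \<in> range (\<lambda>xs. {q. \<forall>i<length xs. q i = xs ! i})"
      by (rule image_eqI[of _ _ "map p [0..<n]"]) (auto simp: cylinder_def)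
  qed
  then show ?thesis by (rule countable_subset) auto
qed

lemma openin_baire_cylinder: "openin baire_space (cylinder p n)"
proof -
  have "cylinder p n = (\<Pi>\<^sub>E i\<in>UNIV. if i < n then {p i} else UNIV)"
    by (auto simp: cylinder_def PiE_def Pi_def split: if_splits)
  moreover have "finite {i. (if i < n then {p i} else UNIV) \<noteq> (UNIV :: nat set)}"
    by (rule finite_subset[of _ "{..<n}"]) auto
  ultimately show ?thesis
    unfolding baire_space_def by (auto simp: openin_PiE_gen)
qed

lemma topspace_baire_space [simp]: "topspace baire_space = UNIV"
  by (simp add: baire_space_def)

text \<open>
  These are the compact subsets of the Baire space: the sets of branches of finitely branching trees.
\<close>
definition compact_branches :: "(nat \<Rightarrow> nat) set \<Rightarrow> bool" where
  "compact_branches K \<longleftrightarrow>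
     (\<forall>p. (\<forall>n. K \<inter> cylinder p n \<noteq> {}) \<longrightarrow> p \<in> K) \<and> (\<forall>n. finite ((\<lambda>p. p n) ` K))"

lemma compact_branches_Int_cylinder:
  assumes "compact_branches K"
  shows "compact_branches (K \<inter> cylinder p n)"
proof -
  have "q \<in> K \<inter> cylinder p n" if q: "\<And>m. (K \<inter> cylinder p n) \<inter> cylinder q m \<noteq> {}" for q
  proof -
    have "q \<in> K" using assms q unfolding compact_branches_def by blast
    moreover from q[of n] obtain x where "x \<in> cylinder p n" "x \<in> cylinder q n" by blast
    then have "q \<in> cylinder p n" using cylinder_eq cylinder_self by metis
    ultimately show ?thesis by simp
  qed
  moreover have "finite ((\<lambda>p. p m) ` (K \<inter> cylinder p n))" for m
    using assms unfolding compact_branches_def by (meson Int_lower1 finite_subset image_mono)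
  ultimately show ?thesis unfolding compact_branches_def by blast
qed

text \<open>
  The hypothesis is conditional so that the lemma also covers sets where the bound on the value at
  \<open>n\<close> depends on the cylinder fixed by the values below \<open>n\<close>.
\<close>
lemma finite_cylinder_traces:
  assumes "\<And>n. finite ((\<lambda>p. cylinder p n) ` K) \<Longrightarrow> finite ((\<lambda>p. p n) ` K)"
  shows "finite ((\<lambda>p. cylinder p n) ` K)"
proof (induction n)
  case 0
  show ?case by (rule finite_subset[of _ "{UNIV}"]) auto
next
  case (Suc n)
  have "cylinder p (Suc n) = cylinder p n \<inter> {q. q n = p n}" for p
    by (auto simp: cylinder_def less_Suc_eq)
  then have "(\<lambda>p. cylinder p (Suc n)) ` K \<subseteq>
      (\<lambda>(C, v). C \<inter> {q. q n = v}) ` ((\<lambda>p. cylinder p n) ` K \<times> (\<lambda>p. p n) ` K)"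
    by force
  then show ?case using Suc assms by (meson finite_SigmaI finite_imageI finite_subset)
qed

section \<open>A refined topology on finite and infinite sequences\<close>

text \<open>
  The points of the space: a branch \<open>p\<close> is represented by \<open>{p}\<close>, a node of the tree of finite
  sequences by the set of branches through it.  No cylinder is a singleton, so the two kinds of points
  do not meet.
\<close>
definition michael_points :: "(nat \<Rightarrow> nat) set set" where
  "michael_points = range (\<lambda>p. {p}) \<union> cylinders"

lemma michael_points_intros [simp]: "{p} \<in> michael_points" "cylinder p n \<in> michael_points"
  by (auto simp: michael_points_def)

lemma michael_points_cases:
  assumes "x \<in> michael_points"
  obtains p where "x = {p}" | p n where "x = cylinder p n"
  using assms by (auto simp: michael_points_def cylinders_def)

text \<open>
  The relation \<open>le q p\<close> is to be read as: the rank of \<open>q\<close> is at most that of \<open>p\<close>.  A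
  neighbourhood of a branch contains the nearby branches of no larger rank; a neighbourhood of a node
  contains all branches that leave the node through an immediate successor of large index, whatever
  their rank.  The set of branches outside a choice of neighbourhoods of all nodes is therefore
  contained in a compact set, since each node then has only finitely many admissible successors.
\<close>
definition michael_open :: "((nat \<Rightarrow> nat) \<Rightarrow> (nat \<Rightarrow> nat) \<Rightarrow> bool) \<Rightarrow> (nat \<Rightarrow> nat) set set \<Rightarrow> bool" where
  "michael_open le W \<longleftrightarrow>
     W \<subseteq> michael_points \<and>
     (\<forall>p. {p} \<in> W \<longrightarrow> (\<exists>n. \<forall>q\<in>cylinder p n. le q p \<longrightarrow> {q} \<in> W)) \<and>
     (\<forall>p n. cylinder p n \<in> W \<longrightarrow> (\<exists>m. \<forall>q\<in>cylinder p n. m \<le> q n \<longrightarrow> {q} \<in> W))"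

lemma michael_openI:
  assumes "W \<subseteq> michael_points"
    and "\<And>p. {p} \<in> W \<Longrightarrow> \<exists>n. \<forall>q\<in>cylinder p n. le q p \<longrightarrow> {q} \<in> W"
    and "\<And>p n. cylinder p n \<in> W \<Longrightarrow> \<exists>m. \<forall>q\<in>cylinder p n. m \<le> q n \<longrightarrow> {q} \<in> W"
  shows "michael_open le W"
  using assms by (simp add: michael_open_def)

lemma michael_openD:
  assumes "michael_open le W"
  shows "W \<subseteq> michael_points"
    and "{p} \<in> W \<Longrightarrow> \<exists>n. \<forall>q\<in>cylinder p n. le q p \<longrightarrow> {q} \<in> W"
    and "cylinder p n \<in> W \<Longrightarrow> \<exists>m. \<forall>q\<in>cylinder p n. m \<le> q n \<longrightarrow> {q} \<in> W"
  using assms by (simp_all add: michael_open_def)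

definition michael_topology :: "((nat \<Rightarrow> nat) \<Rightarrow> (nat \<Rightarrow> nat) \<Rightarrow> bool) \<Rightarrow> (nat \<Rightarrow> nat) set topology" where
  "michael_topology le = topology (michael_open le)"

lemma istopology_michael_open: "istopology (michael_open le)"
  unfolding istopology_def
proof (intro conjI allI impI)
  fix S T assume S: "michael_open le S" and T: "michael_open le T"
  show "michael_open le (S \<inter> T)"
  proof (rule michael_openI)
    show "S \<inter> T \<subseteq> michael_points"
      using michael_openD(1)[OF S] by (rule le_infI1)
  next
    fix p assume "{p} \<in> S \<inter> T"
    then obtain a b where "\<forall>q\<in>cylinder p a. le q p \<longrightarrow> {q} \<in> S" "\<forall>q\<in>cylinder p b. le q p \<longrightarrow> {q} \<in> T"
      using michael_openD(2)[OF S, of p] michael_openD(2)[OF T, of p] by auto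
    moreover have "cylinder p (max a b) \<subseteq> cylinder p a" "cylinder p (max a b) \<subseteq> cylinder p b"
      by (simp_all add: cylinder_antimono)
    ultimately show "\<exists>n. \<forall>q\<in>cylinder p n. le q p \<longrightarrow> {q} \<in> S \<inter> T"
      by (intro exI[of _ "max a b"]) auto
  next
    fix p n assume "cylinder p n \<in> S \<inter> T"
    then obtain a b where "\<forall>q\<in>cylinder p n. a \<le> q n \<longrightarrow> {q} \<in> S" "\<forall>q\<in>cylinder p n. b \<le> q n \<longrightarrow> {q} \<in> T"
      using michael_openD(3)[OF S, of p n] michael_openD(3)[OF T, of p n] by auto
    then show "\<exists>m. \<forall>q\<in>cylinder p n. m \<le> q n \<longrightarrow> {q} \<in> S \<inter> T"
      by (intro exI[of _ "max a b"]) auto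
  qed
next
  fix \<K> assume *: "\<forall>K\<in>\<K>. michael_open le K"
  show "michael_open le (\<Union>\<K>)"
  proof (rule michael_openI)
    show "\<Union>\<K> \<subseteq> michael_points"
      using * michael_openD(1) by (intro Union_least) auto
  next
    fix p assume "{p} \<in> \<Union>\<K>"
    then obtain K where "K \<in> \<K>" "{p} \<in> K" by auto
    then show "\<exists>n. \<forall>q\<in>cylinder p n. le q p \<longrightarrow> {q} \<in> \<Union>\<K>"
      using * michael_openD(2)[of le K p] by auto
  next
    fix p n assume "cylinder p n \<in> \<Union>\<K>"
    then obtain K where "K \<in> \<K>" "cylinder p n \<in> K" by auto
    then show "\<exists>m. \<forall>q\<in>cylinder p n. m \<le> q n \<longrightarrow> {q} \<in> \<Union>\<K>"
      using * michael_openD(3)[of le K p n] by auto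
  qed
qed

lemma openin_michael_topology: "openin (michael_topology le) W \<longleftrightarrow> michael_open le W"
  by (simp add: michael_topology_def istopology_michael_open topology_inverse')

lemma topspace_michael_topology:
  "topspace (michael_topology le) = michael_points"
proof (rule antisym)
  show "topspace (michael_topology le) \<subseteq> michael_points"
    using openin_topspace[of "michael_topology le"]
    unfolding openin_michael_topology by (rule michael_openD(1))
  have "michael_open le (michael_points)"
    by (rule michael_openI) auto
  then show "michael_points \<subseteq> topspace (michael_topology le)"
    by (simp add: openin_michael_topology openin_subset)
qed

text \<open>
  Discarding the relatively open pieces of \<open>K\<close> that have a countable subcover leaves a compact set
  \<open>K'\<close> without such pieces.  If \<open>K'\<close> were nonempty, a point \<open>p\<close> of locally maximal rank would
  contradict this, because any member of the cover at \<open>p\<close> contains the whole of \<open>K'\<close> near \<open>p\<close>.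
\<close>
lemma compact_branches_countable_subcover:
  assumes max: "\<And>K. compact_branches K \<Longrightarrow> K \<noteq> {} \<Longrightarrow> \<exists>p\<in>K. \<exists>n. \<forall>q\<in>K \<inter> cylinder p n. le q p"
    and op: "\<And>W. W \<in> \<U> \<Longrightarrow> michael_open le W"
    and cov: "\<And>p. {p} \<in> \<Union>\<U>"
    and K: "compact_branches K"
  shows "\<exists>\<V>. countable \<V> \<and> \<V> \<subseteq> \<U> \<and> (\<forall>p\<in>K. {p} \<in> \<Union>\<V>)"
proof -
  define small where
    "small L \<longleftrightarrow> (\<exists>\<V>. countable \<V> \<and> \<V> \<subseteq> \<U> \<and> (\<forall>p\<in>L. {p} \<in> \<Union>\<V>))" for L
  have small_mono: "small L" if "small M" "L \<subseteq> M" for L M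
  proof -
    from that(1) obtain \<V> where "countable \<V>" "\<V> \<subseteq> \<U>" "\<forall>p\<in>M. {p} \<in> \<Union>\<V>"
      unfolding small_def by auto
    with that(2) show ?thesis unfolding small_def by (intro exI[of _ \<V>]) (simp add: subset_iff)
  qed
  have small_UN: "small (\<Union>\<L>)" if "countable \<L>" "\<And>L. L \<in> \<L> \<Longrightarrow> small L" for \<L>
  proof -
    have "\<forall>L\<in>\<L>. \<exists>\<V>. countable \<V> \<and> \<V> \<subseteq> \<U> \<and> (\<forall>p\<in>L. {p} \<in> \<Union>\<V>)"
      using that(2) unfolding small_def by blast
    then obtain V where V: "\<forall>L\<in>\<L>. countable (V L) \<and> V L \<subseteq> \<U> \<and> (\<forall>p\<in>L. {p} \<in> \<Union>(V L))"
      by metis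
    then show ?thesis unfolding small_def
    proof (intro exI[of _ "\<Union>L\<in>\<L>. V L"] conjI ballI)
      show "countable (\<Union>L\<in>\<L>. V L)" using that(1) V by (intro countable_UN) auto
      show "(\<Union>L\<in>\<L>. V L) \<subseteq> \<U>" using V by (intro UN_least) simp
      fix p assume "p \<in> \<Union>\<L>"
      then obtain L where "L \<in> \<L>" "p \<in> L" by auto
      with V have "{p} \<in> \<Union>(V L)" "V L \<subseteq> (\<Union>L\<in>\<L>. V L)" by auto
      then show "{p} \<in> \<Union>(\<Union>L\<in>\<L>. V L)" by (meson Union_iff subsetD)
    qed
  qed
  define K' where "K' = {p \<in> K. \<forall>n. \<not> small (K \<inter> cylinder p n)}"
  have "small (K - K')"
  proof (rule small_mono)
    let ?L = "{L \<in> (\<lambda>C. K \<inter> C) ` cylinders. small L}"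
    have "countable ((\<lambda>C. K \<inter> C) ` cylinders)"
      using countable_cylinders by (rule countable_image)
    then show "small (\<Union>?L)" by (intro small_UN) (auto intro: countable_subset)
    show "K - K' \<subseteq> \<Union>?L"
    proof
      fix p assume "p \<in> K - K'"
      then obtain n where "p \<in> K" "small (K \<inter> cylinder p n)" unfolding K'_def by blast
      then show "p \<in> \<Union>?L" by (intro UnionI[of "K \<inter> cylinder p n"]) auto
    qed
  qed
  have "K' = {}"
  proof (rule ccontr)
    assume "K' \<noteq> {}"
    have "p \<in> K'" if p: "\<And>n. K' \<inter> cylinder p n \<noteq> {}" for p
    proof -
      have "p \<in> K" using K p unfolding compact_branches_def K'_def by blast
      moreover have "\<not> small (K \<inter> cylinder p n)" for n
      proof -
        from p[of n] obtain q where "q \<in> K'" "q \<in> cylinder p n" by blast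
        then have "\<not> small (K \<inter> cylinder q n)" by (simp add: K'_def)
        then show ?thesis using cylinder_eq[OF \<open>q \<in> cylinder p n\<close>] by simp
      qed
      ultimately show ?thesis unfolding K'_def by blast
    qed
    moreover have "finite ((\<lambda>p. p n) ` K')" for n
    proof (rule finite_subset)
      show "(\<lambda>p. p n) ` K' \<subseteq> (\<lambda>p. p n) ` K" by (rule image_mono) (auto simp: K'_def)
      show "finite ((\<lambda>p. p n) ` K)" using K by (simp add: compact_branches_def)
    qed
    ultimately have "compact_branches K'" unfolding compact_branches_def by blast
    from max[OF this \<open>K' \<noteq> {}\<close>] obtain p n where p: "p \<in> K'" and
      le: "\<And>q. q \<in> K' \<Longrightarrow> q \<in> cylinder p n \<Longrightarrow> le q p" by blast
    obtain W where W: "W \<in> \<U>" "{p} \<in> W" using cov by blast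
    then obtain m where m: "\<And>q. q \<in> cylinder p m \<Longrightarrow> le q p \<Longrightarrow> {q} \<in> W"
      using michael_openD(2)[OF op[OF W(1)] W(2)] by auto
    have "small (K' \<inter> cylinder p (max n m))"
      unfolding small_def
    proof (intro exI[of _ "{W}"] conjI ballI)
      fix q assume q: "q \<in> K' \<inter> cylinder p (max n m)"
      then have "q \<in> cylinder p n" "q \<in> cylinder p m"
        using cylinder_antimono[of n "max n m" p] cylinder_antimono[of m "max n m" p] by auto
      then show "{q} \<in> \<Union>{W}" using le m q by simp
    qed (use W in auto)
    with \<open>small (K - K')\<close> have "small (\<Union>{K - K', K' \<inter> cylinder p (max n m)})"
      by (intro small_UN) auto
    then have "small (K \<inter> cylinder p (max n m))" by (rule small_mono) auto
    with p show False unfolding K'_def by blast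
  qed
  with \<open>small (K - K')\<close> show ?thesis unfolding small_def by simp
qed

lemma Lindelof_space_michael_topology:
  assumes max: "\<And>K. compact_branches K \<Longrightarrow> K \<noteq> {} \<Longrightarrow> \<exists>p\<in>K. \<exists>n. \<forall>q\<in>K \<inter> cylinder p n. le q p"
  shows "Lindelof_space (michael_topology le)"
  unfolding Lindelof_space_alt
proof (intro allI impI)
  fix \<U> assume "(\<forall>U\<in>\<U>. openin (michael_topology le) U) \<and> topspace (michael_topology le) \<subseteq> \<Union>\<U>"
  then have op: "\<And>W. W \<in> \<U> \<Longrightarrow> michael_open le W" and pts: "michael_points \<subseteq> \<Union>\<U>"
    by (simp_all add: openin_michael_topology topspace_michael_topology)
  have cov: "{p} \<in> \<Union>\<U>" for p
    using pts by (rule subsetD) simp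
  have "\<forall>C\<in>michael_points. \<exists>W. W \<in> \<U> \<and> C \<in> W" using pts by blast
  then obtain w where "\<forall>C\<in>michael_points. w C \<in> \<U> \<and> C \<in> w C" by metis
  then have w: "\<And>p n. w (cylinder p n) \<in> \<U>" "\<And>p n. cylinder p n \<in> w (cylinder p n)"
    by simp_all
  have "\<exists>b. \<forall>p n q. C = cylinder p n \<longrightarrow> q \<in> C \<longrightarrow> b \<le> q n \<longrightarrow> {q} \<in> w C" for C
  proof (cases "\<exists>p n. C = cylinder p n")
    case True
    then obtain p n where C: "C = cylinder p n" by blast
    then obtain b where "\<forall>q\<in>C. b \<le> q n \<longrightarrow> {q} \<in> w C"
      using michael_openD(3)[OF op[OF w(1)] w(2)] by blast
    then show ?thesis using C cylinder_length_inject by metis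
  qed blast
  then obtain b where b: "\<And>p n q. q \<in> cylinder p n \<Longrightarrow> b (cylinder p n) \<le> q n \<Longrightarrow> {q} \<in> w (cylinder p n)"
    by metis
  define K where "K = {p. \<forall>n. p n < b (cylinder p n)}"
  have fin: "finite ((\<lambda>p. p n) ` K)" if "finite ((\<lambda>p. cylinder p n) ` K)" for n
  proof (rule finite_subset)
    show "(\<lambda>p. p n) ` K \<subseteq> (\<Union>C\<in>(\<lambda>p. cylinder p n) ` K. {..<b C})" unfolding K_def by blast
    show "finite (\<Union>C\<in>(\<lambda>p. cylinder p n) ` K. {..<b C})" by (rule finite_UN_I[OF that]) simp
  qed
  have "p \<in> K" if p: "\<And>n. K \<inter> cylinder p n \<noteq> {}" for p
    unfolding K_def
  proof (intro CollectI allI)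
    fix n
    from p[of "Suc n"] obtain q where "q \<in> K" and q: "q \<in> cylinder p (Suc n)" by blast
    then have "q n = p n" "q \<in> cylinder p n" by (auto simp: cylinder_def)
    with \<open>q \<in> K\<close> show "p n < b (cylinder p n)"
      unfolding K_def using cylinder_eq by (metis (mono_tags, lifting) mem_Collect_eq)
  qed
  then have "compact_branches K"
    unfolding compact_branches_def using fin finite_cylinder_traces[of K] by blast
  from compact_branches_countable_subcover[OF max op cov this]
  obtain \<V> where \<V>: "countable \<V>" "\<V> \<subseteq> \<U>" "\<forall>p\<in>K. {p} \<in> \<Union>\<V>" by metis
  show "\<exists>\<V>. countable \<V> \<and> \<V> \<subseteq> \<U> \<and> topspace (michael_topology le) \<subseteq> \<Union>\<V>"
  proof (intro exI[of _ "\<V> \<union> w ` cylinders"] conjI)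
    show "countable (\<V> \<union> w ` cylinders)"
      using \<V>(1) countable_cylinders by blast
    show "\<V> \<union> w ` cylinders \<subseteq> \<U>"
      using \<V>(2) w(1) by (auto simp: cylinders_def)
    have nodes: "w (cylinder p n) \<in> \<V> \<union> w ` cylinders" for p n
      by simp
    have sing: "{p} \<in> \<Union>(\<V> \<union> w ` cylinders)" for p
    proof (cases "p \<in> K")
      case True
      then show ?thesis using \<V>(3) by auto
    next
      case False
      then obtain n where "b (cylinder p n) \<le> p n" unfolding K_def by (auto simp: not_less)
      then have "{p} \<in> w (cylinder p n)" using b[OF cylinder_self] by simp
      with nodes show ?thesis by (rule UnionI)
    qed
    show "topspace (michael_topology le) \<subseteq> \<Union>(\<V> \<union> w ` cylinders)"
      unfolding topspace_michael_topology
    proof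
      fix x assume "x \<in> michael_points"
      then show "x \<in> \<Union>(\<V> \<union> w ` cylinders)"
        by (cases rule: michael_points_cases) (use sing UnionI[OF nodes w(2)] in simp_all)
    qed
  qed
qed

text \<open>
  The obstruction is the diagonal: the set \<open>W b\<close> omits exactly the diagonal points of branches that
  are not below \<open>b\<close>.  It is open because the topology separates a branch \<open>q\<close> from every other
  point of the space by an open set of the space and a cylinder around \<open>q\<close>, and because the
  branches below \<open>b\<close> form an open set.
\<close>
lemma not_Lindelof_michael_times_baire:
  assumes refl: "\<And>p. le p p"
    and trans: "\<And>p q r. le p q \<Longrightarrow> le q r \<Longrightarrow> le p r"
    and unb: "\<And>C. countable C \<Longrightarrow> \<exists>q. \<forall>b\<in>C. \<not> le q b"
  shows "\<not> Lindelof_space (prod_topology (michael_topology le) baire_space)"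
proof
  let ?X = "michael_topology le"
  let ?T = "michael_points \<times> (UNIV :: (nat \<Rightarrow> nat) set)"
  assume lin: "Lindelof_space (prod_topology ?X baire_space)"
  define W where "W b = {(x, q) \<in> ?T. x = {q} \<longrightarrow> le q b}" for b
  have ball: "openin ?X {{p'} | p'. p' \<in> cylinder p n}" for p n
    unfolding openin_michael_topology
  proof (rule michael_openI)
    fix p1 assume "{p1} \<in> {{p'} | p'. p' \<in> cylinder p n}"
    then show "\<exists>k. \<forall>q\<in>cylinder p1 k. le q p1 \<longrightarrow> {q} \<in> {{p'} | p'. p' \<in> cylinder p n}"
      using cylinder_eq[of p1 p n] by (intro exI[of _ n]) auto
  qed (auto simp: cylinder_neq_singleton)
  have down: "openin ?X {{p} | p. le p b}" for b
    unfolding openin_michael_topology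
    by (rule michael_openI) (auto simp: cylinder_neq_singleton intro: trans)
  have node: "openin ?X (insert (cylinder p n) {{p'} | p'. p' \<in> cylinder p n \<and> m \<le> p' n})" for p n m
    unfolding openin_michael_topology
  proof (rule michael_openI)
    fix p1 assume "{p1} \<in> insert (cylinder p n) {{p'} | p'. p' \<in> cylinder p n \<and> m \<le> p' n}"
    then have p1: "p1 \<in> cylinder p n" "m \<le> p1 n" using cylinder_neq_singleton by auto
    have "q \<in> cylinder p n \<and> q n = p1 n" if "q \<in> cylinder p1 (Suc n)" for q
      using that p1(1) by (auto simp: cylinder_def)
    with p1(2) show "\<exists>k. \<forall>q\<in>cylinder p1 k. le q p1 \<longrightarrow>
        {q} \<in> insert (cylinder p n) {{p'} | p'. p' \<in> cylinder p n \<and> m \<le> p' n}"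
      by (intro exI[of _ "Suc n"]) auto
  next
    fix p1 n1 assume "cylinder p1 n1 \<in> insert (cylinder p n) {{p'} | p'. p' \<in> cylinder p n \<and> m \<le> p' n}"
    then have *: "cylinder p1 n1 = cylinder p n" using cylinder_neq_singleton by auto
    then have "n1 = n" by (rule cylinder_length_inject)
    with * show "\<exists>k. \<forall>q\<in>cylinder p1 n1. k \<le> q n1 \<longrightarrow>
        {q} \<in> insert (cylinder p n) {{p'} | p'. p' \<in> cylinder p n \<and> m \<le> p' n}"
      by auto
  qed auto
  have "openin (prod_topology ?X baire_space) (W b)" for b
    unfolding openin_prod_topology_alt
  proof (intro allI impI)
    fix x q assume xq: "(x, q) \<in> W b"
    then have "x \<in> michael_points" by (simp add: W_def)
    then consider p n where "x = cylinder p n" | p where "x = {p}"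
      by (rule michael_points_cases)
    then show "\<exists>U V. openin ?X U \<and> openin baire_space V \<and> x \<in> U \<and> q \<in> V \<and> U \<times> V \<subseteq> W b"
    proof cases
      case 1
      let ?U = "insert (cylinder p n) {{p'} | p'. p' \<in> cylinder p n \<and> Suc (q n) \<le> p' n}"
      have "?U \<times> cylinder q (Suc n) \<subseteq> W b"
        using cylinder_neq_singleton[of p n]
        by (auto simp: W_def) (auto simp: cylinder_def)
      then show ?thesis using 1 node[of p n "Suc (q n)"] openin_baire_cylinder[of q "Suc n"]
        by (intro exI[of _ ?U] exI[of _ "cylinder q (Suc n)"]) simp
    next
      case 2
      show ?thesis
      proof (cases "p = q")
        case True
        with xq 2 have "le p b" by (simp add: W_def)
        moreover have "{{p} | p. le p b} \<times> UNIV \<subseteq> W b"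
          by (auto simp: W_def)
        moreover have "openin baire_space UNIV" using openin_topspace[of baire_space] by simp
        ultimately show ?thesis using 2 down[of b]
          by (intro exI[of _ "{{p} | p. le p b}"] exI[of _ UNIV]) auto
      next
        case False
        then obtain i where i: "p i \<noteq> q i" by blast
        have "{{p'} | p'. p' \<in> cylinder p (Suc i)} \<times> cylinder q (Suc i) \<subseteq> W b"
          using i by (auto simp: W_def) (auto simp: cylinder_def)
        then show ?thesis using 2 ball[of p "Suc i"] openin_baire_cylinder[of q "Suc i"]
          by (intro exI[of _ "{{p'} | p'. p' \<in> cylinder p (Suc i)}"] exI[of _ "cylinder q (Suc i)"]) auto
      qed
    qed
  qed
  then have op: "\<And>V. V \<in> range W \<Longrightarrow> openin (prod_topology ?X baire_space) V" by auto
  have "(x, q) \<in> W q" if "x \<in> michael_points" for x q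
    using refl that by (simp add: W_def)
  then have "?T \<subseteq> \<Union>(range W)" by auto
  then have "\<Union>(range W) = ?T" by (auto simp: W_def)
  then have "\<Union>(range W) = topspace (prod_topology ?X baire_space)"
    by (simp add: topspace_michael_topology)
  from Lindelof_spaceD[OF lin op this]
  obtain \<V> where \<V>: "countable \<V>" "\<V> \<subseteq> range W" "\<Union>\<V> = ?T"
    by (auto simp: topspace_michael_topology)
  then obtain C where "countable C" and C: "\<V> = W ` C" by (metis countable_subset_image)
  from unb[OF this(1)] obtain q where q: "\<forall>b\<in>C. \<not> le q b" by blast
  have "({q}, q) \<in> ?T" by simp
  then obtain b where "b \<in> C" "({q}, q) \<in> W b" unfolding \<V>(3)[symmetric] C by blast
  with q show False by (simp add: W_def)
qed

section \<open>Ultrafilters on the natural numbers\<close>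

text \<open>
  The ultrafilter property in the form in which it is used: negation commutes with the quantifier
  \<open>\<forall>\<^sub>F\<close>.  In particular, comparison of functions modulo \<open>U\<close> is linear.
\<close>
lemma ultrafilter_not_iff:
  assumes "nonprincipal_ultrafilter U"
  shows "\<not> (\<forall>\<^sub>F n in U. P n) \<longleftrightarrow> (\<forall>\<^sub>F n in U. \<not> P n)"
proof
  show "\<forall>\<^sub>F n in U. \<not> P n" if "\<not> (\<forall>\<^sub>F n in U. P n)"
    using assms that unfolding nonprincipal_ultrafilter_def
    by (metis (mono_tags, lifting) Compl_iff eventually_mono mem_Collect_eq)
  show "\<not> (\<forall>\<^sub>F n in U. P n)" if "\<forall>\<^sub>F n in U. \<not> P n"
  proof
    assume "\<forall>\<^sub>F n in U. P n"
    with that have "\<forall>\<^sub>F n in U. False" by eventually_elim simp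
    with assms show False by (simp add: nonprincipal_ultrafilter_def)
  qed
qed

lemma ultrafilter_cofinite:
  assumes "nonprincipal_ultrafilter U" "finite A"
  shows "\<forall>\<^sub>F n in U. n \<notin> A"
proof -
  have "\<forall>\<^sub>F n in U. n \<noteq> k" for k
    using assms(1) ultrafilter_not_iff[OF assms(1), of "\<lambda>n. n = k"]
    by (simp add: nonprincipal_ultrafilter_def)
  then have "\<forall>\<^sub>F n in U. \<forall>k\<in>A. n \<noteq> k" using assms(2) by (simp add: eventually_ball_finite)
  then show ?thesis by eventually_elim auto
qed

lemma ultrafilter_ge_sequentially:
  assumes "nonprincipal_ultrafilter U" "\<forall>\<^sub>F n in sequentially. P n"
  shows "\<forall>\<^sub>F n in U. P n"
proof -
  from assms(2) obtain N where N: "\<And>n. N \<le> n \<Longrightarrow> P n" by (auto simp: eventually_sequentially)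
  have "\<forall>\<^sub>F n in U. n \<notin> {..<N}" using assms(1) by (rule ultrafilter_cofinite) simp
  then show ?thesis by eventually_elim (use N in auto)
qed

lemma infinite_ultrafilter_set:
  assumes "nonprincipal_ultrafilter U" "\<forall>\<^sub>F n in U. n \<in> S"
  shows "infinite S"
  using ultrafilter_cofinite[OF assms(1), of S] assms(2) ultrafilter_not_iff[OF assms(1), of "\<lambda>n. n \<in> S"]
  by blast

text \<open>
  A p-point makes every function that is unbounded modulo \<open>U\<close> tend to infinity along a set in \<open>U\<close>.
\<close>
lemma p_point_uniform_growth:
  fixes \<phi> :: "nat \<Rightarrow> nat"
  assumes U: "p_point U" and \<phi>: "\<And>m. \<forall>\<^sub>F n in U. m \<le> \<phi> n"
  shows "\<exists>B R. (\<forall>\<^sub>F n in U. n \<in> B) \<and> (\<forall>m. \<forall>n\<in>B. R m \<le> n \<longrightarrow> m \<le> \<phi> n)"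
proof -
  have "decseq (\<lambda>m. {n. m \<le> \<phi> n})" by (auto simp: decseq_def)
  moreover have "\<forall>m. \<forall>\<^sub>F n in U. n \<in> {n. m \<le> \<phi> n}" using \<phi> by simp
  ultimately obtain B where B: "\<forall>\<^sub>F n in U. n \<in> B" "\<forall>m. finite (B - {n. m \<le> \<phi> n})"
    using U unfolding p_point_def by blast
  have "\<exists>r. \<forall>n\<in>B. r \<le> n \<longrightarrow> m \<le> \<phi> n" for m
  proof -
    obtain r where "\<forall>n\<in>B - {n. m \<le> \<phi> n}. n < r"
      using B(2) finite_nat_set_iff_bounded by blast
    then show ?thesis by (intro exI[of _ r]) (meson DiffI leD mem_Collect_eq)
  qed
  then show ?thesis using B(1) by metis
qed

lemma interval_index:
  fixes c :: "nat \<Rightarrow> nat"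
  assumes "c 0 = 0" "strict_mono c"
  obtains idx where "\<And>n. c (idx n) \<le> n" "\<And>n. n < c (Suc (idx n))"
proof -
  have "\<exists>j. c j \<le> n \<and> n < c (Suc j)" for n
  proof (induction n)
    case 0
    show ?case using assms by (intro exI[of _ 0]) (metis le0 lessI strict_monoD)
  next
    case (Suc n)
    then obtain j where "c j \<le> n" "n < c (Suc j)" by blast
    then show ?case
      using strict_monoD[OF assms(2), of "Suc j" "Suc (Suc j)"]
      by (cases "Suc n < c (Suc j)") (auto intro: exI[of _ j] exI[of _ "Suc j"])
  qed
  then show thesis using that by metis
qed

section \<open>Lower bounds for functions tending to infinity\<close>

lemma below_bounding_number:
  assumes "|H| <o bounding_number"
  shows "\<exists>g. \<forall>f\<in>H. f \<le>\<^sup>* g"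
proof (rule ccontr)
  assume "\<nexists>g. \<forall>f\<in>H. f \<le>\<^sup>* g"
  then have "\<forall>g. \<exists>f\<in>H. \<not> f \<le>\<^sup>* g" by blast
  then have "bounding_number \<le>o |H|"
    unfolding bounding_number_def by (rule least_card(2)[rotated]) (rule \<open>\<forall>g. \<exists>f\<in>H. \<not> f \<le>\<^sup>* g\<close>)
  with assms show False using not_ordLess_ordLeq by blast
qed

lemma below_groupwise_density_number:
  assumes "|\<G>| <o groupwise_density_number" "\<And>G. G \<in> \<G> \<Longrightarrow> groupwise_dense G"
  shows "\<Inter>\<G> \<noteq> {}"
proof
  assume "\<Inter>\<G> = {}"
  then have *: "(\<forall>G\<in>\<G>. groupwise_dense G) \<and> \<Inter>\<G> = {}" using assms(2) by blast
  then have "groupwise_density_number \<le>o |\<G>|"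
    unfolding groupwise_density_number_def by (rule least_card(2)[rotated]) (rule *)
  with assms(1) show False using not_ordLess_ordLeq by blast
qed

text \<open>
  A common bound \<open>h\<close> on the rates at which the members of \<open>\<Phi>\<close> tend to infinity can be inverted
  to a function \<open>\<psi>\<close> that tends to infinity more slowly than all of them.
\<close>
lemma lower_bound_bounding:
  fixes \<Phi> :: "(nat \<Rightarrow> nat) set"
  assumes U: "p_point U" and card: "|\<Phi>| <o bounding_number"
    and \<Phi>: "\<And>\<phi> m. \<phi> \<in> \<Phi> \<Longrightarrow> \<forall>\<^sub>F n in U. m \<le> \<phi> n"
  shows "\<exists>\<psi>. filterlim \<psi> at_top sequentially \<and> (\<forall>\<phi>\<in>\<Phi>. \<forall>\<^sub>F n in U. \<psi> n \<le> \<phi> n)"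
proof -
  have np: "nonprincipal_ultrafilter U" using U by (simp add: p_point_def)
  have "\<forall>\<phi>\<in>\<Phi>. \<exists>B R. (\<forall>\<^sub>F n in U. n \<in> B) \<and> (\<forall>m. \<forall>n\<in>B. R m \<le> n \<longrightarrow> m \<le> \<phi> n)"
    using p_point_uniform_growth[OF U \<Phi>] by blast
  then obtain B R where BR: "\<And>\<phi>. \<phi> \<in> \<Phi> \<Longrightarrow> \<forall>\<^sub>F n in U. n \<in> B \<phi>"
      "\<And>\<phi> m n. \<phi> \<in> \<Phi> \<Longrightarrow> n \<in> B \<phi> \<Longrightarrow> R \<phi> m \<le> n \<Longrightarrow> m \<le> \<phi> n"
    by metis
  have "|R ` \<Phi>| <o bounding_number" using card card_of_image ordLeq_ordLess_trans by blast
  then obtain h where h: "\<And>\<phi>. \<phi> \<in> \<Phi> \<Longrightarrow> R \<phi> \<le>\<^sup>* h" using below_bounding_number by blast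
  define \<psi> where "\<psi> n = Max {m. m \<le> n \<and> (m = 0 \<or> h m \<le> n)}" for n
  have fin: "finite {m. m \<le> n \<and> (m = 0 \<or> h m \<le> n)}" for n by simp
  have ne: "{m. m \<le> n \<and> (m = 0 \<or> h m \<le> n)} \<noteq> {}" for n by auto
  have \<psi>_in: "\<psi> n \<le> n \<and> (\<psi> n = 0 \<or> h (\<psi> n) \<le> n)" for n
    using Max_in[OF fin ne, of n] unfolding \<psi>_def by blast
  have lim: "filterlim \<psi> at_top sequentially"
    unfolding filterlim_at_top eventually_sequentially
  proof (intro allI exI impI)
    fix m n assume "max m (h m) \<le> n"
    then show "m \<le> \<psi> n" unfolding \<psi>_def by (intro Max_ge[OF fin]) auto
  qed
  have "\<forall>\<^sub>F n in U. \<psi> n \<le> \<phi> n" if "\<phi> \<in> \<Phi>" for \<phi>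
  proof -
    from h[OF that] obtain m0 where m0: "\<And>m. m0 \<le> m \<Longrightarrow> R \<phi> m \<le> h m"
      unfolding le_star_def finite_nat_set_iff_bounded by (metis leD mem_Collect_eq not_le)
    have "\<forall>\<^sub>F n in U. Suc m0 \<le> \<psi> n"
      using lim by (intro ultrafilter_ge_sequentially[OF np]) (simp add: filterlim_at_top)
    with BR(1)[OF that] show ?thesis
    proof eventually_elim
      case (elim n)
      with \<psi>_in[of n] have "h (\<psi> n) \<le> n" by auto
      with m0[of "\<psi> n"] elim show ?case by (intro BR(2)[OF that]) auto
    qed
  qed
  with lim show ?thesis by blast
qed

text \<open>
  The inserted \<open>0\<close> is the default when \<open>A\<close> has no element up to \<open>n\<close>.
\<close>
definition last_below :: "nat set \<Rightarrow> nat \<Rightarrow> nat" where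
  "last_below A n = Max (insert 0 (A \<inter> {..n}))"

lemma last_below_leI:
  "(\<And>x. x \<in> A \<Longrightarrow> x \<le> n \<Longrightarrow> x \<le> b) \<Longrightarrow> last_below A n \<le> b"
  by (simp add: last_below_def)

lemma last_below_ge: "x \<in> A \<Longrightarrow> x \<le> n \<Longrightarrow> x \<le> last_below A n"
  by (simp add: last_below_def)

lemma filterlim_last_below:
  assumes "infinite A"
  shows "filterlim (last_below A) at_top sequentially"
  unfolding filterlim_at_top eventually_sequentially
proof
  fix m
  from assms obtain x where "m \<le> x" "x \<in> A" unfolding infinite_nat_iff_unbounded_le by blast
  then show "\<exists>N. \<forall>n\<ge>N. m \<le> last_below A n"
    by (meson last_below_ge order_trans)
qed

text \<open>
  The clause on interval partitions carries the argument.  Cut the natural numbers into long blocks,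
  each containing an interval of the given partition, such that after the end of a block the values of
  \<open>\<phi>\<close> along a set in \<open>U\<close> are at least every element of its interval.  Failures of the
  inequality are then confined to the blocks whose interval is selected.  The blocks of one parity form
  a set in \<open>U\<close>, and selecting the intervals in the blocks of the other parity avoids the failures.
\<close>
lemma groupwise_dense_last_below:
  fixes \<phi> :: "nat \<Rightarrow> nat"
  assumes U: "p_point U" and \<phi>: "\<And>m. \<forall>\<^sub>F n in U. m \<le> \<phi> n"
  shows "groupwise_dense {A. infinite A \<and> (\<forall>\<^sub>F n in U. last_below A n \<le> \<phi> n)}"
    (is "groupwise_dense ?G")
  unfolding groupwise_dense_def
proof (intro conjI ballI allI impI)
  have np: "nonprincipal_ultrafilter U" using U by (simp add: p_point_def)
  fix A assume A: "A \<in> ?G"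
  then show "infinite A" by simp
  show "B \<in> ?G" if B: "B \<subseteq> A \<and> infinite B" for B
  proof -
    have "last_below B n \<le> last_below A n" for n
      using B by (intro last_below_leI last_below_ge) auto
    then have "\<forall>\<^sub>F n in U. last_below B n \<le> \<phi> n"
      using A by (auto elim!: eventually_mono intro: order_trans)
    with B show ?thesis by simp
  qed
  show "B \<in> ?G" if B: "finite (A - B) \<and> finite (B - A)" for B
  proof -
    have "A \<subseteq> B \<union> (A - B)" by blast
    then have inf: "infinite B" using A B by (auto dest: finite_subset)
    obtain k where k: "\<And>x. x \<in> B - A \<Longrightarrow> x < k"
      using B finite_nat_set_iff_bounded by metis
    obtain a where a: "k \<le> a" "a \<in> A"
      using A infinite_nat_iff_unbounded_le by (metis (mono_tags, lifting) mem_Collect_eq)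
    have "last_below B n \<le> last_below A n" if "a \<le> n" for n
    proof (rule last_below_leI)
      fix x assume "x \<in> B" "x \<le> n"
      then show "x \<le> last_below A n"
        using k[of x] a that last_below_ge[of x A n] last_below_ge[of a A n] by (cases "x \<in> A") auto
    qed
    then have "\<forall>\<^sub>F n in U. last_below B n \<le> last_below A n"
      by (intro ultrafilter_ge_sequentially[OF np]) (auto simp: eventually_sequentially)
    moreover have "\<forall>\<^sub>F n in U. last_below A n \<le> \<phi> n" using A by simp
    ultimately have "\<forall>\<^sub>F n in U. last_below B n \<le> \<phi> n" by eventually_elim simp
    with inf show ?thesis by simp
  qed
next
  have np: "nonprincipal_ultrafilter U" using U by (simp add: p_point_def)
  fix I assume I: "interval_partition I"
  obtain B R where B: "\<forall>\<^sub>F n in U. n \<in> B" and R: "\<And>m n. n \<in> B \<Longrightarrow> R m \<le> n \<Longrightarrow> m \<le> \<phi> n"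
    using p_point_uniform_growth[OF U \<phi>] by blast
  have far: "\<exists>j. I j \<subseteq> {k..}" for k
  proof -
    have "\<forall>n. \<exists>j. n \<in> I j" using I unfolding interval_partition_def by blast
    then obtain j where j: "\<And>n. n \<in> I (j n)" by metis
    have fin: "finite (\<Union>i\<in>j ` {..<k}. I i)"
    proof (rule finite_UN_I)
      show "finite (I i)" for i using I unfolding interval_partition_def by (metis finite_atLeastLessThan)
    qed simp
    then obtain n where n: "n \<notin> (\<Union>i\<in>j ` {..<k}. I i)" using ex_new_if_finite infinite_UNIV_nat by blast
    have "k \<le> x" if "x \<in> I (j n)" for x
    proof (rule ccontr)
      assume "\<not> k \<le> x"
      moreover have "j x = j n"
        using I j[of x] that unfolding interval_partition_def disjoint_family_on_def by blast
      moreover have "n \<notin> I (j x)" using n \<open>\<not> k \<le> x\<close> by auto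
      ultimately show False using j[of n] by simp
    qed
    then show ?thesis by auto
  qed
  have "\<exists>c. \<forall>i. (i = 0 \<longrightarrow> c i = (0::nat)) \<and> (c i < c (Suc i) \<and>
      (\<exists>j. I j \<subseteq> {c i..<c (Suc i)} \<and> (\<forall>x\<in>I j. \<forall>n\<in>B. c (Suc i) \<le> n \<longrightarrow> x \<le> \<phi> n)))"
  proof (rule dependent_nat_choice)
    fix k i :: nat
    obtain j where j: "I j \<subseteq> {k..}" using far by blast
    obtain a b where ab: "a < b" "I j = {a..<b}" using I unfolding interval_partition_def by blast
    let ?k = "max b (R b)"
    have "\<forall>x\<in>I j. \<forall>n\<in>B. ?k \<le> n \<longrightarrow> x \<le> \<phi> n" using R ab(2) by fastforce
    moreover have "I j \<subseteq> {k..<?k}" "k < ?k" using j ab by force+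
    ultimately show "\<exists>k'. (Suc i = 0 \<longrightarrow> k' = 0) \<and> (k < k' \<and>
        (\<exists>j. I j \<subseteq> {k..<k'} \<and> (\<forall>x\<in>I j. \<forall>n\<in>B. k' \<le> n \<longrightarrow> x \<le> \<phi> n)))"
      by (intro exI[of _ ?k]) auto
  qed auto
  then obtain c where c0: "c 0 = 0" and cless: "\<And>i. c i < c (Suc i)" and
    "\<And>i. \<exists>j. I j \<subseteq> {c i..<c (Suc i)} \<and> (\<forall>x\<in>I j. \<forall>n\<in>B. c (Suc i) \<le> n \<longrightarrow> x \<le> \<phi> n)"
    by metis
  then obtain J where J: "\<And>i. I (J i) \<subseteq> {c i..<c (Suc i)}"
    "\<And>i x n. x \<in> I (J i) \<Longrightarrow> n \<in> B \<Longrightarrow> c (Suc i) \<le> n \<Longrightarrow> x \<le> \<phi> n" by metis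
  have mono: "strict_mono c" using cless by (simp add: strict_mono_Suc_iff)
  obtain idx where idx: "\<And>n. c (idx n) \<le> n" "\<And>n. n < c (Suc (idx n))"
    using interval_index[OF c0 mono] by metis
  \<comment> \<open>\<open>P\<close> is the parity of the blocks preferred by \<open>U\<close>; the intervals are taken from the others.\<close>
  obtain P where P: "\<forall>\<^sub>F n in U. P (idx n)" "infinite {i. \<not> P i}"
  proof (cases "\<forall>\<^sub>F n in U. even (idx n)")
    case True
    have "infinite {i::nat. \<not> even i}"
      unfolding infinite_nat_iff_unbounded_le mem_Collect_eq by presburger
    with True show thesis by (rule that)
  next
    case False
    then have "\<forall>\<^sub>F n in U. odd (idx n)" using ultrafilter_not_iff[OF np] by blast
    moreover have "infinite {i::nat. \<not> odd i}"
      unfolding infinite_nat_iff_unbounded_le mem_Collect_eq by presburger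
    ultimately show thesis by (rule that)
  qed
  have Jne: "I (J i) \<noteq> {}" for i
    using I unfolding interval_partition_def by (metis atLeastLessThan_empty_iff not_le)
  have Jinj: "inj J"
  proof (rule injI, rule ccontr)
    fix i i' assume J': "J i = J i'" and "i \<noteq> i'"
    obtain x where "x \<in> I (J i)" using Jne by blast
    then have "c i \<le> x" "x < c (Suc i)" "c i' \<le> x" "x < c (Suc i')" using J(1) J' by fastforce+
    then have "c i < c (Suc i')" "c i' < c (Suc i)" by linarith+
    then have "i < Suc i'" "i' < Suc i" using strict_mono_less[OF mono] by blast+
    with \<open>i \<noteq> i'\<close> show False by simp
  qed
  show "\<exists>A. infinite A \<and> (\<Union>n\<in>A. I n) \<in> ?G"
  proof (intro exI[of _ "J ` {i. \<not> P i}"] conjI CollectI)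
    show infJ: "infinite (J ` {i. \<not> P i})"
      using P(2) Jinj by (simp add: finite_image_iff inj_on_subset)
    show "infinite (\<Union>n\<in>J ` {i. \<not> P i}. I n)"
      unfolding infinite_nat_iff_unbounded_le
    proof
      fix m
      obtain i where i: "m \<le> i" "\<not> P i" using P(2) unfolding infinite_nat_iff_unbounded_le by auto
      obtain x where x: "x \<in> I (J i)" using Jne by blast
      with J(1)[of i] have "c i \<le> x" by auto
      then have "m \<le> x" using i(1) strict_mono_imp_increasing[OF mono, of i] by linarith
      then show "\<exists>x\<ge>m. x \<in> (\<Union>n\<in>J ` {i. \<not> P i}. I n)" using x i(2) by auto
    qed
    show "\<forall>\<^sub>F n in U. last_below (\<Union>n\<in>J ` {i. \<not> P i}. I n) n \<le> \<phi> n"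
      using P(1) B
    proof eventually_elim
      case (elim n)
      show ?case
      proof (rule last_below_leI)
        fix x assume "x \<in> (\<Union>n\<in>J ` {i. \<not> P i}. I n)" "x \<le> n"
        then obtain i where i: "\<not> P i" "x \<in> I (J i)" by auto
        with J(1)[of i] \<open>x \<le> n\<close> idx(2)[of n] have "c i < c (Suc (idx n))" by fastforce
        then have "i < Suc (idx n)" using strict_mono_less[OF mono] by blast
        moreover have "i \<noteq> idx n" using i elim by blast
        ultimately have "Suc i \<le> idx n" by simp
        then have "c (Suc i) \<le> n" using idx(1)[of n] strict_mono_less_eq[OF mono] order_trans by blast
        with i elim show "x \<le> \<phi> n" by (intro J(2)) auto
      qed
    qed
  qed
qed

text \<open>
  A set \<open>A\<close> common to the groupwise dense families of all members of \<open>\<Phi>\<close> gives the lower bound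
  \<open>last_below A\<close>.
\<close>
lemma lower_bound_groupwise_density:
  fixes \<Phi> :: "(nat \<Rightarrow> nat) set"
  assumes U: "p_point U" and card: "|\<Phi>| <o groupwise_density_number"
    and \<Phi>: "\<And>\<phi> m. \<phi> \<in> \<Phi> \<Longrightarrow> \<forall>\<^sub>F n in U. m \<le> \<phi> n"
  shows "\<exists>\<psi>. filterlim \<psi> at_top sequentially \<and> (\<forall>\<phi>\<in>\<Phi>. \<forall>\<^sub>F n in U. \<psi> n \<le> \<phi> n)"
proof (cases "\<Phi> = {}")
  case True
  then show ?thesis using filterlim_ident by (intro exI[of _ "\<lambda>n. n"]) simp
next
  case False
  define G where "G \<phi> = {A. infinite A \<and> (\<forall>\<^sub>F n in U. last_below A n \<le> \<phi> n)}" for \<phi>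
  have "|G ` \<Phi>| <o groupwise_density_number" using card card_of_image ordLeq_ordLess_trans by blast
  then have "\<Inter>(G ` \<Phi>) \<noteq> {}"
    using groupwise_dense_last_below[OF U \<Phi>] by (intro below_groupwise_density_number) (auto simp: G_def)
  then obtain A where A: "\<And>\<phi>. \<phi> \<in> \<Phi> \<Longrightarrow> A \<in> G \<phi>" by blast
  with False have "infinite A" by (auto simp: G_def)
  then show ?thesis using A filterlim_last_below by (intro exI[of _ "last_below A"]) (auto simp: G_def)
qed

section \<open>Selective ultrafilters and compact sets\<close>

text \<open>
  The q-point property leaves at most one element in each block of a partition that grows fast with
  respect to \<open>\<psi>\<close>; keeping the blocks of one parity separates the remaining elements by a whole
  block.
\<close>
lemma q_point_sparse:
  fixes \<psi> :: "nat \<Rightarrow> nat"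
  assumes U: "q_point U" and \<psi>: "filterlim \<psi> at_top sequentially"
  shows "\<exists>S. (\<forall>\<^sub>F n in U. n \<in> S) \<and> (\<forall>a\<in>S. \<forall>b\<in>S. a < b \<longrightarrow> a < \<psi> b)"
proof -
  have np: "nonprincipal_ultrafilter U" using U by (simp add: q_point_def)
  have "\<exists>c. \<forall>i. (i = 0 \<longrightarrow> c i = (0::nat)) \<and> (c i < c (Suc i) \<and> (\<forall>n\<ge>c (Suc i). c i \<le> \<psi> n))"
  proof (rule dependent_nat_choice)
    fix k i :: nat
    obtain N where "\<forall>n\<ge>N. k \<le> \<psi> n"
      using \<psi> unfolding filterlim_at_top eventually_sequentially by blast
    then show "\<exists>k'. (Suc i = 0 \<longrightarrow> k' = 0) \<and> (k < k' \<and> (\<forall>n\<ge>k'. k \<le> \<psi> n))"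
      by (intro exI[of _ "max N (Suc k)"]) auto
  qed auto
  then obtain c where c0: "c 0 = 0" and cless: "\<And>i. c i < c (Suc i)"
    and c: "\<And>i n. c (Suc i) \<le> n \<Longrightarrow> c i \<le> \<psi> n" by metis
  have mono: "strict_mono c" using cless by (simp add: strict_mono_Suc_iff)
  obtain idx where idx: "\<And>n. c (idx n) \<le> n" "\<And>n. n < c (Suc (idx n))"
    using interval_index[OF c0 mono] by metis
  have idx_eq: "idx n = i" if "c i \<le> n" "n < c (Suc i)" for n i
  proof -
    have "c i < c (Suc (idx n))" "c (idx n) < c (Suc i)"
      using that idx[of n] by (meson order_le_less_trans)+
    then show ?thesis using strict_mono_less[OF mono] by (metis less_Suc_eq_le order_antisym)
  qed
  have "interval_partition (\<lambda>i. {c i..<c (Suc i)})"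
    unfolding interval_partition_def
  proof (intro conjI allI)
    show "\<exists>a b. a < b \<and> {c i..<c (Suc i)} = {a..<b}" for i using cless by blast
    show "disjoint_family (\<lambda>i. {c i..<c (Suc i)})"
      unfolding disjoint_family_on_def
    proof (intro ballI impI)
      fix m n :: nat assume "m \<noteq> n"
      then show "{c m..<c (Suc m)} \<inter> {c n..<c (Suc n)} = {}"
        using idx_eq[of m] idx_eq[of n] by (metis atLeastLessThan_iff disjoint_iff)
    qed
    show "(\<Union>i. {c i..<c (Suc i)}) = UNIV" using idx by fastforce
  qed
  then obtain B where B: "\<forall>\<^sub>F n in U. n \<in> B" "\<And>k. card (B \<inter> {c k..<c (Suc k)}) \<le> 1"
    using U unfolding q_point_def by blast
  obtain P where P: "\<forall>\<^sub>F n in U. P (idx n)" "\<And>i. P i \<Longrightarrow> \<not> P (Suc i)"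
  proof (cases "\<forall>\<^sub>F n in U. even (idx n)")
    case True
    then show thesis by (rule that) simp
  next
    case False
    then have "\<forall>\<^sub>F n in U. odd (idx n)" using ultrafilter_not_iff[OF np] by blast
    then show thesis by (rule that) simp
  qed
  have "a < \<psi> b" if a: "a \<in> B" "P (idx a)" and b: "b \<in> B" "P (idx b)" and "a < b" for a b
  proof -
    have "idx a \<noteq> idx b"
    proof
      assume eq: "idx a = idx b"
      have "a \<in> B \<inter> {c (idx a)..<c (Suc (idx a))}" "b \<in> B \<inter> {c (idx a)..<c (Suc (idx a))}"
        using a b idx[of a] idx[of b] eq by auto
      moreover have "finite (B \<inter> {c (idx a)..<c (Suc (idx a))})" by simp
      ultimately have "a = b" using B(2)[of "idx a"] by (metis One_nat_def card_le_Suc0_iff_eq)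
      with \<open>a < b\<close> show False by simp
    qed
    moreover have "idx a \<le> idx b"
    proof -
      have "c (idx a) < c (Suc (idx b))" using idx(1)[of a] idx(2)[of b] \<open>a < b\<close> by linarith
      then show ?thesis using strict_mono_less[OF mono] by (metis less_Suc_eq_le)
    qed
    moreover have "Suc (idx a) \<noteq> idx b" using P(2) a b by metis
    ultimately have "Suc (Suc (idx a)) \<le> idx b" by simp
    then have "c (Suc (Suc (idx a))) \<le> b"
      using idx(1)[of b] strict_mono_less_eq[OF mono] order_trans by blast
    then have "c (Suc (idx a)) \<le> \<psi> b" by (rule c)
    with idx(2)[of a] show ?thesis by simp
  qed
  moreover have "\<forall>\<^sub>F n in U. n \<in> {n \<in> B. P (idx n)}" using B(1) P(1) by eventually_elim simp
  ultimately show ?thesis by (intro exI[of _ "{n \<in> B. P (idx n)}"]) blast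
qed

text \<open>
  The pointwise maximum of a compact set need not belong to the set, nor agree modulo \<open>U\<close> with
  a member of it; this is why ranks of compact sets need the argument below.
\<close>
definition envelope :: "(nat \<Rightarrow> nat) set \<Rightarrow> nat \<Rightarrow> nat" where
  "envelope K i = Max ((\<lambda>q. q i) ` K)"

lemma compact_branches_finite_values: "compact_branches K \<Longrightarrow> finite ((\<lambda>q. q i) ` K)"
  by (simp add: compact_branches_def)

lemma envelope_ge: "compact_branches K \<Longrightarrow> q \<in> K \<Longrightarrow> q i \<le> envelope K i"
  by (simp add: envelope_def compact_branches_finite_values)

lemma envelope_attained:
  assumes "compact_branches K" "K \<noteq> {}"
  obtains q where "q \<in> K" "q i = envelope K i"
proof -
  have "envelope K i \<in> (\<lambda>q. q i) ` K"
    unfolding envelope_def using assms by (intro Max_in compact_branches_finite_values) auto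
  then show thesis using that by auto
qed

lemma envelope_mono:
  assumes "compact_branches K" "L \<subseteq> K" "L \<noteq> {}"
  shows "envelope L i \<le> envelope K i"
  unfolding envelope_def
  using assms by (intro Max_mono image_mono compact_branches_finite_values) auto

text \<open>
  If a function of \<open>E\<close> is exceeded modulo \<open>U\<close> by the envelope of every piece of \<open>K\<close>, then for
  almost all \<open>i\<close> it is exceeded at \<open>i\<close> by the envelopes of all pieces down to some depth, and this
  depth is unbounded modulo \<open>U\<close>.  As \<open>E\<close> is small, there is one function \<open>\<psi>\<close> that tends to
  infinity below all these depths.  Choose a set \<open>S\<close> in \<open>U\<close> that is sparse with respect to
  \<open>\<psi>\<close>, and build \<open>p\<close> along \<open>S\<close>: at each element of \<open>S\<close> the value of \<open>p\<close> is made as large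
  as the part of \<open>p\<close> already fixed permits.  Sparseness says that this part, which ends just after
  the previous element of \<open>S\<close>, is no longer than the depth to which the envelopes exceed every function
  of \<open>E\<close>.
\<close>
lemma selective_escape:
  fixes E :: "(nat \<Rightarrow> nat) set"
  assumes U: "selective_ultrafilter U"
    and K: "compact_branches K" "K \<noteq> {}"
    and low: "\<And>\<Phi> :: (nat \<Rightarrow> nat) set. |\<Phi>| \<le>o |E| \<Longrightarrow>
        (\<And>\<phi> m. \<phi> \<in> \<Phi> \<Longrightarrow> \<forall>\<^sub>F n in U. m \<le> \<phi> n) \<Longrightarrow>
        \<exists>\<psi>. filterlim \<psi> at_top sequentially \<and> (\<forall>\<phi>\<in>\<Phi>. \<forall>\<^sub>F n in U. \<psi> n \<le> \<phi> n)"
    and big: "\<And>f q m. f \<in> E \<Longrightarrow> q \<in> K \<Longrightarrow> \<forall>\<^sub>F i in U. f i < envelope (K \<inter> cylinder q m) i"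
  shows "\<exists>p\<in>K. \<forall>f\<in>E. \<forall>\<^sub>F i in U. f i < p i"
proof -
  have p_pt: "p_point U" and q_pt: "q_point U" using U by (auto simp: selective_ultrafilter_def)
  then have np: "nonprincipal_ultrafilter U" by (simp add: p_point_def)
  note Kc = compact_branches_Int_cylinder[OF K(1)]
  define B where "B f m = {i. \<forall>q\<in>K. f i < envelope (K \<inter> cylinder q m) i}" for f m
  have B: "\<forall>\<^sub>F i in U. i \<in> B f m" if "f \<in> E" for f m
  proof -
    have "finite ((\<lambda>q. cylinder q m) ` K)"
      by (intro finite_cylinder_traces compact_branches_finite_values K(1))
    moreover have "\<forall>C\<in>(\<lambda>q. cylinder q m) ` K. \<forall>\<^sub>F i in U. f i < envelope (K \<inter> C) i"
      using big[OF that] by auto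
    ultimately have "\<forall>\<^sub>F i in U. \<forall>C\<in>(\<lambda>q. cylinder q m) ` K. f i < envelope (K \<inter> C) i"
      by (rule eventually_ball_finite)
    then show ?thesis by eventually_elim (auto simp: B_def)
  qed
  define depth where "depth f i = Max {m. m \<le> i \<and> (m = 0 \<or> i \<in> B f m)}" for f i
  have fin: "finite {m. m \<le> i \<and> (m = 0 \<or> i \<in> B f m)}" for f i by simp
  have depth_in: "depth f i = 0 \<or> i \<in> B f (depth f i)" for f i
  proof -
    have "{m. m \<le> i \<and> (m = 0 \<or> i \<in> B f m)} \<noteq> {}" by auto
    from Max_in[OF fin this] show ?thesis unfolding depth_def by blast
  qed
  have depth_unb: "\<forall>\<^sub>F i in U. m \<le> depth f i" if "f \<in> E" for f m
  proof -
    have "\<forall>\<^sub>F i in U. m \<le> i"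
      by (rule ultrafilter_ge_sequentially[OF np]) (simp add: eventually_ge_at_top)
    with B[OF that, of m] show ?thesis
    proof eventually_elim
      case (elim i)
      then show ?case unfolding depth_def by (intro Max_ge[OF fin]) simp
    qed
  qed
  have "|depth ` E| \<le>o |E|" by (rule card_of_image)
  from low[OF this] depth_unb obtain \<psi> where \<psi>: "filterlim \<psi> at_top sequentially"
    "\<And>f. f \<in> E \<Longrightarrow> \<forall>\<^sub>F n in U. \<psi> n \<le> depth f n" by blast
  obtain S where S: "\<forall>\<^sub>F n in U. n \<in> S" and sparse: "\<And>a b. a \<in> S \<Longrightarrow> b \<in> S \<Longrightarrow> a < b \<Longrightarrow> a < \<psi> b"
    using q_point_sparse[OF q_pt \<psi>(1)] by blast
  have infS: "infinite S" using np S by (rule infinite_ultrafilter_set)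
  define e where "e = enumerate S"
  have e_S: "e j \<in> S" for j unfolding e_def using infS by (rule enumerate_in_set)
  have e_less: "e j < e (Suc j)" for j unfolding e_def using infS by (rule enumerate_step)
  have e_ge: "j \<le> e j" for j unfolding e_def using infS by (rule le_enumerate)
  \<comment> \<open>The length of the part of the branch that is fixed before the value at \<open>e j\<close> is chosen.\<close>
  define l where "l j = (case j of 0 \<Rightarrow> 0 | Suc i \<Rightarrow> Suc (e i))" for j
  have l_simps [simp]: "l 0 = 0" "l (Suc j) = Suc (e j)" for j by (simp_all add: l_def)
  have l_mono: "l j \<le> l k" if "j \<le> k" for j k
  proof (rule lift_Suc_mono_le[OF _ that])
    show "l n \<le> l (Suc n)" for n using e_less[of "n - 1"] by (cases n) auto
  qed
  have "\<exists>x. \<forall>j. x j \<in> K \<and> (x (Suc j) \<in> cylinder (x j) (l j) \<and>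
      x (Suc j) (e j) = envelope (K \<inter> cylinder (x j) (l j)) (e j))"
  proof (rule dependent_nat_choice)
    show "\<exists>x. x \<in> K" using K(2) by blast
    fix y j assume "y \<in> K"
    then have "K \<inter> cylinder y (l j) \<noteq> {}" using cylinder_self by blast
    with Kc obtain q where "q \<in> K \<inter> cylinder y (l j)" "q (e j) = envelope (K \<inter> cylinder y (l j)) (e j)"
      by (rule envelope_attained)
    then show "\<exists>q. q \<in> K \<and> (q \<in> cylinder y (l j) \<and> q (e j) = envelope (K \<inter> cylinder y (l j)) (e j))"
      by blast
  qed
  then obtain x where x_K: "\<And>j. x j \<in> K" and x_cyl: "\<And>j. x (Suc j) \<in> cylinder (x j) (l j)"
    and x_env: "\<And>j. x (Suc j) (e j) = envelope (K \<inter> cylinder (x j) (l j)) (e j)" by metis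
  have stable: "x k i = x j i" if "j \<le> k" "i < l j" for i j k
    using that
  proof (induction k rule: dec_induct)
    case (step k)
    then have "i < l k" using l_mono[of j k] by simp
    then have "x (Suc k) i = x k i" using x_cyl[of k] by (simp add: cylinder_def)
    with step show ?case by simp
  qed simp
  define p where "p i = x (Suc i) i" for i
  have p_eq: "p i = x j i" if "i < l j" for i j
  proof (cases "j \<le> Suc i")
    case True
    then show ?thesis unfolding p_def using that by (rule stable)
  next
    case False
    moreover have "i < l (Suc i)" using e_ge[of i] by simp
    ultimately show ?thesis unfolding p_def using stable[of "Suc i" j i] by simp
  qed
  have p_cyl: "cylinder (x j) (l j) = cylinder p (l j)" for j
    by (rule cylinder_eq[symmetric]) (simp add: cylinder_def p_eq)
  have "p \<in> K"
  proof -
    have "x (Suc n) \<in> K \<inter> cylinder p n" for n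
    proof -
      have "i < l (Suc n)" if "i < n" for i using that e_ge[of n] by simp
      then have "x (Suc n) i = p i" if "i < n" for i using that p_eq by metis
      then show ?thesis using x_K by (simp add: cylinder_def)
    qed
    then have "\<forall>n. K \<inter> cylinder p n \<noteq> {}" by blast
    then show ?thesis using K(1) by (simp add: compact_branches_def)
  qed
  moreover have "\<forall>\<^sub>F i in U. f i < p i" if "f \<in> E" for f
    using S \<psi>(2)[OF that] depth_unb[OF that, of 1]
  proof eventually_elim
    case (elim i)
    then obtain j where j: "i = e j" unfolding e_def using range_enumerate[OF infS] by blast
    have "l j \<le> depth f i"
    proof (cases j)
      case (Suc k)
      then have "e k < \<psi> (e j)" using sparse e_S e_less by simp
      with Suc j elim show ?thesis by simp
    qed simp
    have "i \<in> B f (depth f i)" using depth_in[of f i] elim by simp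
    then have "f i < envelope (K \<inter> cylinder p (depth f i)) i" using \<open>p \<in> K\<close> by (simp add: B_def)
    also have "\<dots> \<le> envelope (K \<inter> cylinder p (l j)) i"
      using \<open>p \<in> K\<close> cylinder_antimono[OF \<open>l j \<le> depth f i\<close>, of p] cylinder_self
      by (intro envelope_mono Kc) blast+
    also have "\<dots> = x (Suc j) i" using x_env[of j] p_cyl[of j] j by simp
    also have "\<dots> = p i" using p_eq[of i "Suc j"] j by simp
    finally show ?case .
  qed
  ultimately show ?thesis by blast
qed

text \<open>
  The rank \<open>rk p\<close> is the first function of the well-ordered family \<open>D\<close> that bounds \<open>p\<close> modulo
  \<open>U\<close>.  Pass to a piece \<open>L\<close> of \<open>K\<close> whose envelope has the least rank \<open>\<delta>\<close> among all pieces.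
  Then the fewer than \<open>|D|\<close> predecessors of \<open>\<delta>\<close> bound no envelope of a smaller piece, so
  some \<open>p\<close> in \<open>L\<close> escapes them all and has rank at least \<open>\<delta>\<close>, while no element of \<open>L\<close>
  has rank above that of the envelope.
\<close>
lemma rank_local_max:
  fixes D :: "(nat \<Rightarrow> nat) set" and rk :: "(nat \<Rightarrow> nat) \<Rightarrow> (nat \<Rightarrow> nat)"
  assumes U: "selective_ultrafilter U"
    and rk_in: "\<And>p. rk p \<in> D"
    and rk_ge: "\<And>p. \<forall>\<^sub>F i in U. p i \<le> rk p i"
    and rk_least: "\<And>p f. f \<in> D \<Longrightarrow> \<forall>\<^sub>F i in U. p i \<le> f i \<Longrightarrow> (rk p, f) \<in> |D|"
    and low: "\<And>\<Phi> :: (nat \<Rightarrow> nat) set. |\<Phi>| <o |D| \<Longrightarrow>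
        (\<And>\<phi> m. \<phi> \<in> \<Phi> \<Longrightarrow> \<forall>\<^sub>F n in U. m \<le> \<phi> n) \<Longrightarrow>
        \<exists>\<psi>. filterlim \<psi> at_top sequentially \<and> (\<forall>\<phi>\<in>\<Phi>. \<forall>\<^sub>F n in U. \<psi> n \<le> \<phi> n)"
    and K: "compact_branches K" "K \<noteq> {}"
  shows "\<exists>p\<in>K. \<exists>n. \<forall>q\<in>K \<inter> cylinder p n. (rk q, rk p) \<in> |D|"
proof -
  have np: "nonprincipal_ultrafilter U" using U by (simp add: selective_ultrafilter_def p_point_def)
  have wo: "wo_rel |D|" by (simp add: wo_rel_def card_of_Well_order)
  note tr = transD[OF wo_rel.TRANS[OF wo]]
  let ?M = "{rk (envelope (K \<inter> cylinder p n)) | p n. p \<in> K}"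
  have M: "?M \<subseteq> Field |D|" "?M \<noteq> {}" using rk_in K(2) by (auto simp: Field_card_of)
  define \<delta> where "\<delta> = wo_rel.minim |D| ?M"
  have \<delta>_least: "(\<delta>, rk (envelope (K \<inter> cylinder p n))) \<in> |D|" if "p \<in> K" for p n
    unfolding \<delta>_def using that by (intro wo_rel.minim_least[OF wo M(1)]) blast
  have "\<delta> \<in> ?M" unfolding \<delta>_def by (rule wo_rel.minim_in[OF wo M])
  then obtain p0 n0 where p0: "p0 \<in> K" and \<delta>: "\<delta> = rk (envelope (K \<inter> cylinder p0 n0))" by blast
  define L where "L = K \<inter> cylinder p0 n0"
  have L: "compact_branches L" "L \<noteq> {}" "L \<subseteq> K"
    unfolding L_def using p0 cylinder_self compact_branches_Int_cylinder[OF K(1)] by auto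
  define E where "E = underS |D| \<delta>"
  have \<delta>_D: "\<delta> \<in> D" unfolding \<delta> by (rule rk_in)
  have card_E: "|E| <o |D|"
    unfolding E_def using \<delta>_D by (intro card_of_underS card_of_Card_order) (simp add: Field_card_of)
  have E_iff: "f \<in> E \<longleftrightarrow> f \<in> D \<and> (\<delta>, f) \<notin> |D|" for f
  proof
    assume "f \<in> E"
    then have f: "f \<noteq> \<delta>" "(f, \<delta>) \<in> |D|" by (auto simp: E_def underS_def)
    then have "f \<in> D" using Field_card_of by (metis FieldI1)
    with f show "f \<in> D \<and> (\<delta>, f) \<notin> |D|" using antisymD[OF wo_rel.ANTISYM[OF wo]] by blast
  next
    assume f: "f \<in> D \<and> (\<delta>, f) \<notin> |D|"
    have "(\<delta>, \<delta>) \<in> |D|" using wo_rel.REFL[OF wo] \<delta>_D by (auto simp: refl_on_def Field_card_of)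
    with f have "f \<noteq> \<delta>" by blast
    moreover from this f \<delta>_D have "(f, \<delta>) \<in> |D|"
      using wo_rel.TOTAL[OF wo] unfolding total_on_def by (metis Field_card_of)
    ultimately show "f \<in> E" by (simp add: E_def underS_def)
  qed
  have "\<exists>p\<in>L. \<forall>f\<in>E. \<forall>\<^sub>F i in U. f i < p i"
  proof (rule selective_escape[OF U L(1,2)])
    fix \<Phi> :: "(nat \<Rightarrow> nat) set"
    assume "|\<Phi>| \<le>o |E|" and unb: "\<And>\<phi> m. \<phi> \<in> \<Phi> \<Longrightarrow> \<forall>\<^sub>F n in U. m \<le> \<phi> n"
    then have "|\<Phi>| <o |D|" using card_E ordLeq_ordLess_trans by blast
    then show "\<exists>\<psi>. filterlim \<psi> at_top sequentially \<and> (\<forall>\<phi>\<in>\<Phi>. \<forall>\<^sub>F n in U. \<psi> n \<le> \<phi> n)"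
      using unb by (rule low)
  next
    fix f q m assume f: "f \<in> E" and q: "q \<in> L"
    have "cylinder p0 n0 = cylinder q n0" using q by (intro cylinder_eq[symmetric]) (simp add: L_def)
    moreover have "cylinder q n0 \<inter> cylinder q m = cylinder q (max n0 m)"
      by (auto simp: cylinder_def less_max_iff_disj)
    ultimately have "L \<inter> cylinder q m = K \<inter> cylinder q (max n0 m)" by (auto simp: L_def)
    then have "(\<delta>, rk (envelope (L \<inter> cylinder q m))) \<in> |D|" using \<delta>_least q L(3) by auto
    then have "(rk (envelope (L \<inter> cylinder q m)), f) \<notin> |D|" using f tr unfolding E_iff by blast
    then have "\<not> (\<forall>\<^sub>F i in U. envelope (L \<inter> cylinder q m) i \<le> f i)"
      using rk_least f unfolding E_iff by blast
    then show "\<forall>\<^sub>F i in U. f i < envelope (L \<inter> cylinder q m) i"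
      unfolding ultrafilter_not_iff[OF np] by (simp add: not_le)
  qed
  then obtain p where p: "p \<in> L" and esc: "\<And>f. f \<in> E \<Longrightarrow> \<forall>\<^sub>F i in U. f i < p i" by blast
  have "rk p \<notin> E"
  proof
    assume "rk p \<in> E"
    from esc[OF this] rk_ge[of p] have "\<forall>\<^sub>F i in U. False" by eventually_elim simp
    with np show False by (simp add: nonprincipal_ultrafilter_def)
  qed
  then have \<delta>_le: "(\<delta>, rk p) \<in> |D|" using rk_in E_iff by blast
  have "(rk q, rk p) \<in> |D|" if "q \<in> K \<inter> cylinder p n0" for q
  proof -
    have "cylinder p n0 = cylinder p0 n0" using p by (intro cylinder_eq) (simp add: L_def)
    with that have "q \<in> L" by (simp add: L_def)
    have "\<forall>\<^sub>F i in U. q i \<le> \<delta> i"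
      using rk_ge[of "envelope L"]
    proof eventually_elim
      case (elim i)
      with envelope_ge[OF L(1) \<open>q \<in> L\<close>, of i] show ?case by (simp add: \<delta> L_def)
    qed
    with \<delta>_D have "(rk q, \<delta>) \<in> |D|" by (rule rk_least)
    with \<delta>_le show ?thesis using tr by blast
  qed
  with p L(3) show ?thesis by blast
qed

section \<open>Existence of a Michael space\<close>

theorem mainTheorem2:
  assumes "\<exists>U. selective_ultrafilter U"
    and "is_max_card bounding_number groupwise_density_number dominating_number"
  shows "\<exists>X :: (nat \<Rightarrow> nat) set topology. Michael_space X"
proof -
  obtain U where U: "selective_ultrafilter U" using assms(1) by blast
  then have p_pt: "p_point U" by (simp add: selective_ultrafilter_def)
  then have np: "nonprincipal_ultrafilter U" by (simp add: p_point_def)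
  define dom where "dom D \<longleftrightarrow> (\<forall>g. \<exists>f\<in>D. \<forall>\<^sub>F i in U. g i \<le> f i)" for D :: "(nat \<Rightarrow> nat) set"
  have "dom UNIV" unfolding dom_def
  proof
    show "\<exists>f\<in>UNIV. \<forall>\<^sub>F i in U. g i \<le> f i" for g :: "nat \<Rightarrow> nat" by (rule bexI[of _ g]) simp_all
  qed
  then obtain D where D: "dom D" and D_card: "least_card dom = |D|"
    using least_card(1)[of dom] by blast
  have D_least: "|D| \<le>o |B|" if "dom B" for B
    unfolding D_card[symmetric] using that that by (rule least_card(2))
  have D_dominating: "|D| \<le>o dominating_number"
  proof -
    have "\<exists>f\<in>UNIV. g \<le>\<^sup>* f" for g by (rule bexI[of _ g]) (simp_all add: le_star_def)
    then obtain D' where D': "\<forall>g. \<exists>f\<in>D'. g \<le>\<^sup>* f" "dominating_number = |D'|"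
      unfolding dominating_number_def using least_card(1)[of "\<lambda>D. \<forall>g. \<exists>f\<in>D. g \<le>\<^sup>* f" UNIV] by blast
    have "dom D'" unfolding dom_def
    proof
      fix g
      obtain f where "f \<in> D'" "finite {n. f n < g n}" using D'(1) unfolding le_star_def by blast
      then have "\<forall>\<^sub>F n in U. n \<notin> {n. f n < g n}" using np ultrafilter_cofinite by blast
      then have "\<forall>\<^sub>F n in U. g n \<le> f n" by eventually_elim simp
      with \<open>f \<in> D'\<close> show "\<exists>f\<in>D'. \<forall>\<^sub>F n in U. g n \<le> f n" by blast
    qed
    then show ?thesis unfolding D'(2) by (rule D_least)
  qed
  have low: "\<exists>\<psi>. filterlim \<psi> at_top sequentially \<and> (\<forall>\<phi>\<in>\<Phi>. \<forall>\<^sub>F n in U. \<psi> n \<le> \<phi> n)"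
    if "|\<Phi>| <o |D|" and \<Phi>: "\<And>\<phi> m. \<phi> \<in> \<Phi> \<Longrightarrow> \<forall>\<^sub>F n in U. m \<le> \<phi> n" for \<Phi> :: "(nat \<Rightarrow> nat) set"
  proof -
    have less: "|\<Phi>| <o dominating_number" using that(1) D_dominating by (rule ordLess_ordLeq_trans)
    from assms(2) have "bounding_number =o dominating_number \<or> groupwise_density_number =o dominating_number"
      by (simp add: is_max_card_def)
    then show ?thesis
    proof
      assume "bounding_number =o dominating_number"
      with less have "|\<Phi>| <o bounding_number" using ordIso_symmetric ordLess_ordIso_trans by blast
      with p_pt show ?thesis using \<Phi> by (rule lower_bound_bounding)
    next
      assume "groupwise_density_number =o dominating_number"
      with less have "|\<Phi>| <o groupwise_density_number" using ordIso_symmetric ordLess_ordIso_trans by blast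
      with p_pt show ?thesis using \<Phi> by (rule lower_bound_groupwise_density)
    qed
  qed
  have wo: "wo_rel |D|" by (simp add: wo_rel_def card_of_Well_order)
  define rk where "rk p = wo_rel.minim |D| {f \<in> D. \<forall>\<^sub>F i in U. p i \<le> f i}" for p
  have "rk p \<in> {f \<in> D. \<forall>\<^sub>F i in U. p i \<le> f i}" for p
    unfolding rk_def using D by (intro wo_rel.minim_in[OF wo]) (auto simp: dom_def Field_card_of)
  then have rk_in: "\<And>p. rk p \<in> D" and rk_ge: "\<And>p. \<forall>\<^sub>F i in U. p i \<le> rk p i" by auto
  have rk_least: "(rk p, f) \<in> |D|" if "f \<in> D" "\<forall>\<^sub>F i in U. p i \<le> f i" for p f
    unfolding rk_def using that by (intro wo_rel.minim_least[OF wo]) (auto simp: Field_card_of)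
  define le where "le q p \<longleftrightarrow> (rk q, rk p) \<in> |D|" for q p
  have lin: "Lindelof_space (michael_topology le)"
    unfolding le_def
    by (rule Lindelof_space_michael_topology) (rule rank_local_max[OF U rk_in rk_ge rk_least low])
  have not_below: "\<exists>g. \<forall>q. le q b \<longrightarrow> \<not> (\<forall>\<^sub>F i in U. g i \<le> q i)" for b
  proof -
    have "|underS |D| (rk b)| <o |D|"
      using rk_in by (intro card_of_underS card_of_Card_order) (simp add: Field_card_of)
    then have "\<not> dom (underS |D| (rk b))" using D_least not_ordLess_ordLeq by blast
    then obtain g where g: "\<And>f. f \<in> underS |D| (rk b) \<Longrightarrow> \<not> (\<forall>\<^sub>F i in U. g i \<le> f i)"
      unfolding dom_def by blast
    \<comment> \<open>The term \<open>Suc (rk b i)\<close> also excludes functions of the same rank as \<open>b\<close>.\<close>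
    show ?thesis
    proof (intro exI[of _ "\<lambda>i. max (g i) (Suc (rk b i))"] allI impI notI)
      fix q assume "le q b" and "\<forall>\<^sub>F i in U. max (g i) (Suc (rk b i)) \<le> q i"
      then have *: "\<forall>\<^sub>F i in U. max (g i) (Suc (rk b i)) \<le> rk q i"
        using rk_ge[of q] by (auto elim: eventually_elim2)
      show False
      proof (cases "rk q = rk b")
        case True
        from * have "\<forall>\<^sub>F i in U. False" by eventually_elim (simp add: True)
        with np show False by (simp add: nonprincipal_ultrafilter_def)
      next
        case False
        with \<open>le q b\<close> have "rk q \<in> underS |D| (rk b)" by (simp add: le_def underS_def)
        moreover from * have "\<forall>\<^sub>F i in U. g i \<le> rk q i" by eventually_elim simp
        ultimately show False using g by blast
      qed
    qed
  qed
  then obtain g where g: "\<And>b q. le q b \<Longrightarrow> \<not> (\<forall>\<^sub>F i in U. g b i \<le> q i)" by metis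
  have unb: "\<exists>q. \<forall>b\<in>C. \<not> le q b" if "countable C" for C
  proof (cases "C = {}")
    case False
    define q where "q i = (\<Sum>k\<le>i. g (from_nat_into C k) i)" for i
    have "\<not> le q b" if "b \<in> C" for b
    proof
      assume "le q b"
      obtain k where k: "b = from_nat_into C k"
        using from_nat_into_surj[OF \<open>countable C\<close> \<open>b \<in> C\<close>] by metis
      have "g b i \<le> q i" if "k \<le> i" for i
        unfolding q_def k using that by (intro member_le_sum) auto
      then have "\<forall>\<^sub>F i in U. g b i \<le> q i"
        by (intro ultrafilter_ge_sequentially[OF np]) (auto simp: eventually_sequentially)
      with g[OF \<open>le q b\<close>] show False by simp
    qed
    then show ?thesis by blast
  qed simp
  have "\<not> Lindelof_space (prod_topology (michael_topology le) baire_space)"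
  proof (rule not_Lindelof_michael_times_baire)
    show "le p p" for p
      using wo_rel.REFL[OF wo] rk_in by (auto simp: le_def refl_on_def Field_card_of)
    show "le p r" if "le p q" "le q r" for p q r
      using that transD[OF wo_rel.TRANS[OF wo]] unfolding le_def by blast
  qed (rule unb)
  with lin show ?thesis unfolding Michael_space_def by blast
qed

end
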